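(* Let $U:\mathbb{R}^n\to\mathbb{R}$ and $\varphi:\mathbb{R}^n_+\to\mathbb{R}_+$ be continuously differentiable functions such that $U$ is pseudoconcave, $\varphi$ is quasilinear, $\nabla U(x)\ge 0$ for all $x\in\mathbb{R}^n$, and $\nabla\varphi(x)\gneq 0$ for all $x>0$. Let $(\bar x,\bar y)\in\hat S$ be such that $\bar x\ge0$, $\bar y\ge 0$ and $\bar x_i\bar y_i=0$ for all $i=1,\dots,n$. Then $(\bar x,\bar y)$ solves problem $(Q)$ if and only if there exist $\mu\in\mathbb{R}^n_+$ and $\lambda\in\mathbb{R}$ such that $$\left(-\nabla f(\bar x,\bar y)+\mu^{T}\nabla g(\bar x,\bar y)+\lambda\nabla h(\bar x,\bar y)\right)(x-\bar x,\,y-\bar y)\ge 0\quad\text{for every }(x,y)\in\hat S,$$ $$\mu^{T}g(\bar x,\bar y)=0,\qquad h(\bar x,\bar y)=0.$$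
   Context: Let $n\ge 1$, let $R\in\mathbb{R}^n$ with $R_i>0$ for all $i$ (the reserves), and let $\Gamma$ be the diagonal $n\times n$ matrix with diagonal entries $\gamma_1,\dots,\gamma_n$, where $0<\gamma_i<1$. For vectors, $x\ge y$ means $x_i\ge y_i$ for all $i$; $x\gneq y$ means $x\ge y$ and $x\ne y$; $x>0$ means $x_i>0$ for all $i$. $\mathbb{R}^n_+$ is the set of vectors $x\ge 0$, and $\mathbb{R}_+=[0,\infty)$. Given a utility function $U:\mathbb{R}^n\to\mathbb{R}$ and a trading function $\varphi:\mathbb{R}^n_+\to\mathbb{R}_+$, problem $(Q)$ is: maximize $U(x-y)$ over $(x,y)\in\mathbb{R}^n\times\mathbb{R}^n$ subject to $\varphi(R+\Gamma y-x)=\varphi(R)$, $R+\Gamma y-x\ge 0$, $R\ge x\ge 0$, $y\ge 0$. Put $f(x,y)=U(x-y)$, $h(x,y)=\varphi(R+\Gamma y-x)-\varphi(R)$, $g(x,y)=-R-\Gamma y+x$, and $\hat S=\{(x,y)\in\mathbb{R}^n\times\mathbb{R}^n: R\ge x\ge 0,\ y\ge 0\}$. Here $\nabla f,\nabla h$ (row vectors) and $\nabla g$ (the Jacobian) are the derivatives with respect to $(x,y)$: $\nabla f(\bar x,\bar y)=(\nabla U(\bar x-\bar y)^T,\,-\nabla U(\bar x-\bar y)^T)$, $\nabla g(\bar x,\bar y)=(I_n,\,-\Gamma)$, and $\nabla h(\bar x,\bar y)=(-\bar P^{T},\,\bar P^{T}\Gamma)$ with $\bar P=\nabla\varphi(R+\Gamma\bar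 y-\bar x)$. A differentiable function $h:\mathbb{R}^n\to\mathbb{R}$ is pseudoconvex if $h(x)<h(y)$ implies $\langle\nabla h(y),x-y\rangle<0$; $h$ is pseudoconcave if $-h$ is pseudoconvex. A function $h$ with convex domain is quasiconvex if $h(\lambda x+(1-\lambda)y)\le\max\{h(x),h(y)\}$ for all $x,y$ in its domain and $\lambda\in[0,1]$; $h$ is quasilinear if both $h$ and $-h$ are quasiconvex. *)

theory Defs
  imports "HOL-Analysis.Analysis"
begin

text \<open>
  On vectors of type \<^typ>\<open>real ^ 'n\<close> the library order \<open>\<le>\<close> is the componentwise one, but its
  strict version \<open>x < y\<close> means \<open>x \<le> y \<and> x \<noteq> y\<close>. A vector all of whose entries are positive
  is therefore described explicitly by \<open>\<forall>i. 0 < x $ i\<close>.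
\<close>

subsection \<open>Gradients and generalized convexity\<close>

text \<open>
  The gradient of a function with domain \<open>S\<close>: at points of the boundary of \<open>S\<close> the derivative is
  the one relative to \<open>S\<close>. It is meaningful where this derivative exists and is unique
  (see \<open>gradient_on_eqI\<close>), which is the case for all the domains used below.
\<close>

definition gradient_on :: "'a::euclidean_space set \<Rightarrow> ('a \<Rightarrow> real) \<Rightarrow> 'a \<Rightarrow> 'a" where
  "gradient_on S f x = (THE D. (f has_derivative (\<lambda>v. D \<bullet> v)) (at x within S))"

abbreviation gradient :: "('a::euclidean_space \<Rightarrow> real) \<Rightarrow> 'a \<Rightarrow> 'a" where
  "gradient \<equiv> gradient_on UNIV"

definition C1_on :: "'a::euclidean_space set \<Rightarrow> ('a \<Rightarrow> real) \<Rightarrow> bool" where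
  "C1_on S f \<longleftrightarrow> f differentiable_on S \<and> continuous_on S (gradient_on S f)"

definition pseudoconvex :: "('a::euclidean_space \<Rightarrow> real) \<Rightarrow> bool" where
  "pseudoconvex h \<longleftrightarrow>
     h differentiable_on UNIV \<and> (\<forall>x y. h x < h y \<longrightarrow> gradient h y \<bullet> (x - y) < 0)"

definition pseudoconcave :: "('a::euclidean_space \<Rightarrow> real) \<Rightarrow> bool" where
  "pseudoconcave h \<longleftrightarrow> pseudoconvex (\<lambda>x. - h x)"

definition quasiconvex_on :: "'a::real_vector set \<Rightarrow> ('a \<Rightarrow> real) \<Rightarrow> bool" where
  "quasiconvex_on S h \<longleftrightarrow> convex S \<and>
     (\<forall>x\<in>S. \<forall>y\<in>S. \<forall>t\<in>{0..1}. h (t *\<^sub>R x + (1 - t) *\<^sub>R y) \<le> max (h x) (h y))"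

definition quasilinear_on :: "'a::real_vector set \<Rightarrow> ('a \<Rightarrow> real) \<Rightarrow> bool" where
  "quasilinear_on S h \<longleftrightarrow> quasiconvex_on S h \<and> quasiconvex_on S (\<lambda>x. - h x)"

subsection \<open>The trading problem\<close>

definition orthant :: "(real ^ 'n) set" where
  "orthant = {x. 0 \<le> x}"

definition diag :: "real ^ 'n \<Rightarrow> real ^ 'n ^ 'n" where
  "diag \<gamma> = (\<chi> i j. if i = j then \<gamma> $ i else 0)"

definition f_fun :: "(real ^ 'n \<Rightarrow> real) \<Rightarrow> (real ^ 'n) \<times> (real ^ 'n) \<Rightarrow> real" where
  "f_fun U = (\<lambda>(x, y). U (x - y))"

definition h_fun :: "(real ^ 'n \<Rightarrow> real) \<Rightarrow> real ^ 'n \<Rightarrow> real ^ 'n ^ 'n \<Rightarrow>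
    (real ^ 'n) \<times> (real ^ 'n) \<Rightarrow> real" where
  "h_fun \<phi> R \<Gamma> = (\<lambda>(x, y). \<phi> (R + \<Gamma> *v y - x) - \<phi> R)"

definition g_fun :: "real ^ 'n \<Rightarrow> real ^ 'n ^ 'n \<Rightarrow> (real ^ 'n) \<times> (real ^ 'n) \<Rightarrow> real ^ 'n" where
  "g_fun R \<Gamma> = (\<lambda>(x, y). - R - \<Gamma> *v y + x)"

text \<open>The trading function is given on the nonnegative orthant only, so this is the domain of
  \<^term>\<open>h_fun \<phi> R \<Gamma>\<close>.\<close>

definition h_dom :: "real ^ 'n \<Rightarrow> real ^ 'n ^ 'n \<Rightarrow> ((real ^ 'n) \<times> (real ^ 'n)) set" where
  "h_dom R \<Gamma> = {(x, y). R + \<Gamma> *v y - x \<in> orthant}"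

definition S_hat :: "real ^ 'n \<Rightarrow> ((real ^ 'n) \<times> (real ^ 'n)) set" where
  "S_hat R = {(x, y). x \<le> R \<and> 0 \<le> x \<and> 0 \<le> y}"

definition feasible_Q :: "(real ^ 'n \<Rightarrow> real) \<Rightarrow> real ^ 'n \<Rightarrow> real ^ 'n ^ 'n \<Rightarrow>
    ((real ^ 'n) \<times> (real ^ 'n)) set" where
  "feasible_Q \<phi> R \<Gamma> = {(x, y). \<phi> (R + \<Gamma> *v y - x) = \<phi> R \<and> 0 \<le> R + \<Gamma> *v y - x \<and>
     x \<le> R \<and> 0 \<le> x \<and> 0 \<le> y}"

definition solves_Q :: "(real ^ 'n \<Rightarrow> real) \<Rightarrow> (real ^ 'n \<Rightarrow> real) \<Rightarrow> real ^ 'n \<Rightarrow> real ^ 'n ^ 'n \<Rightarrow>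
    real ^ 'n \<Rightarrow> real ^ 'n \<Rightarrow> bool" where
  "solves_Q U \<phi> R \<Gamma> x y \<longleftrightarrow>
     (x, y) \<in> feasible_Q \<phi> R \<Gamma> \<and> (\<forall>(x', y')\<in>feasible_Q \<phi> R \<Gamma>. U (x' - y') \<le> U (x - y))"

subsection \<open>The derivatives are the expected ones\<close>

lemma gradient_on_eqI:
  fixes f :: "'a::euclidean_space \<Rightarrow> real"
  assumes "(f has_derivative (\<lambda>v. D \<bullet> v)) (at x within S)"
    and "\<And>i e. i \<in> Basis \<Longrightarrow> e > 0 \<Longrightarrow> \<exists>d. 0 < \<bar>d\<bar> \<and> \<bar>d\<bar> < e \<and> x + d *\<^sub>R i \<in> S"
  shows "gradient_on S f x = D"
  unfolding gradient_on_def
proof (rule the_equality)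
  fix D' assume "(f has_derivative (\<lambda>v. D' \<bullet> v)) (at x within S)"
  then have "(\<lambda>v. D' \<bullet> v) = (\<lambda>v. D \<bullet> v)"
    using assms by (intro frechet_derivative_unique_within)
  then show "D' = D"
    by (metis inner_commute vector_eq_ldot)
qed (fact assms(1))

lemma gradient_eqI:
  fixes f :: "'a::euclidean_space \<Rightarrow> real"
  assumes "(f has_derivative (\<lambda>v. D \<bullet> v)) (at x)"
  shows "gradient f x = D"
proof (rule gradient_on_eqI)
  show "\<exists>d. 0 < \<bar>d\<bar> \<and> \<bar>d\<bar> < e \<and> x + d *\<^sub>R i \<in> UNIV" if "e > 0" for i e
    using that by (intro exI[of _ "e / 2"]) simp
qed (use assms in simp)

lemma has_derivative_gradient_onI:
  fixes f :: "'a::euclidean_space \<Rightarrow> real"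
  assumes "f differentiable (at x within S)"
    and "\<And>i e. i \<in> Basis \<Longrightarrow> e > 0 \<Longrightarrow> \<exists>d. 0 < \<bar>d\<bar> \<and> \<bar>d\<bar> < e \<and> x + d *\<^sub>R i \<in> S"
  shows "(f has_derivative (\<lambda>v. gradient_on S f x \<bullet> v)) (at x within S)"
proof -
  obtain f' where f': "(f has_derivative f') (at x within S)"
    using assms(1) by (auto simp: differentiable_def)
  interpret linear f'
    using f' by (rule has_derivative_linear)
  define D where "D = (\<Sum>b\<in>Basis. f' b *\<^sub>R b)"
  have "f' v = D \<bullet> v" for v
  proof -
    have "f' v = f' (\<Sum>b\<in>Basis. (v \<bullet> b) *\<^sub>R b)"
      by (simp add: euclidean_representation)
    also have "\<dots> = D \<bullet> v"
      by (simp add: sum scale D_def inner_sum_left inner_commute[of v] mult.commute)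
    finally show ?thesis .
  qed
  then have "(f has_derivative (\<lambda>v. D \<bullet> v)) (at x within S)"
    using f' by (metis (no_types, lifting) has_derivative_eq_rhs ext)
  with gradient_on_eqI[OF this assms(2)] show ?thesis
    by simp
qed

lemma orthant_basis_direction:
  fixes x :: "real ^ 'n"
  assumes "x \<in> orthant" "i \<in> Basis" "e > 0"
  shows "\<exists>d. 0 < \<bar>d\<bar> \<and> \<bar>d\<bar> < e \<and> x + d *\<^sub>R i \<in> orthant"
  using assms
  by (intro exI[of _ "e / 2"])
     (auto simp: orthant_def less_eq_vec_def Basis_vec_def axis_def)

lemma diag_mult: "diag \<gamma> *v y = (\<chi> i. \<gamma> $ i * y $ i)"
  by (simp add: diag_def matrix_vector_mult_def vec_eq_iff if_distrib[of "\<lambda>z. z * _"]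
      sum.delta cong: if_cong)

lemma diag_inner: "v \<bullet> (diag \<gamma> *v y) = (diag \<gamma> *v v) \<bullet> y"
  by (simp add: diag_mult inner_vec_def mult_ac)

lemma h_dom_basis_direction:
  fixes \<gamma> R :: "real ^ 'n"
  assumes "z \<in> h_dom R (diag \<gamma>)" "\<forall>i. 0 < \<gamma> $ i" "b \<in> Basis" "e > 0"
  shows "\<exists>d. 0 < \<bar>d\<bar> \<and> \<bar>d\<bar> < e \<and> z + d *\<^sub>R b \<in> h_dom R (diag \<gamma>)"
proof -
  obtain x y where z: "z = (x, y)" by force
  have ge: "0 \<le> R $ i + \<gamma> $ i * y $ i - x $ i" for i
    using assms(1) by (auto simp: h_dom_def z orthant_def less_eq_vec_def diag_mult)
  from assms(3) consider k where "b = (axis k 1, 0)" | k where "b = (0, axis k 1)"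
    by (auto simp: Basis_prod_def Basis_vec_def)
  then show ?thesis
  proof cases
    case 1
    have "0 \<le> R $ i + \<gamma> $ i * y $ i - (x $ i - e / 2)" for i
      using ge[of i] assms(4) by simp
    then have "z + (- e / 2) *\<^sub>R b \<in> h_dom R (diag \<gamma>)"
      using ge by (auto simp: h_dom_def z 1 orthant_def less_eq_vec_def diag_mult axis_def)
    then show ?thesis using assms(4) by (intro exI[of _ "- e / 2"]) auto
  next
    case 2
    have "0 \<le> R $ i + \<gamma> $ i * (y $ i + e / 2) - x $ i" for i
    proof -
      have "0 < \<gamma> $ i * (e / 2)"
        using assms(2,4) by simp
      then show ?thesis
        using ge[of i] unfolding distrib_left by linarith
    qed
    then have "z + (e / 2) *\<^sub>R b \<in> h_dom R (diag \<gamma>)"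
      using ge by (auto simp: h_dom_def z 2 orthant_def less_eq_vec_def diag_mult axis_def)
    then show ?thesis using assms(4) by (intro exI[of _ "e / 2"]) auto
  qed
qed

lemma gradient_f_fun:
  fixes U :: "real ^ 'n \<Rightarrow> real"
  assumes "U differentiable (at (x - y))"
  shows "gradient (f_fun U) (x, y) = (gradient U (x - y), - gradient U (x - y))"
proof (rule gradient_eqI)
  have U: "(U has_derivative (\<lambda>v. gradient U (x - y) \<bullet> v)) (at (x - y))"
  proof (rule has_derivative_gradient_onI)
    show "\<exists>d. 0 < \<bar>d\<bar> \<and> \<bar>d\<bar> < e \<and> x - y + d *\<^sub>R i \<in> UNIV" if "e > 0" for i e
      using that by (intro exI[of _ "e / 2"]) simp
  qed (use assms in simp)
  have "((\<lambda>z. U (fst z - snd z)) has_derivative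
      (\<lambda>v. gradient U (x - y) \<bullet> (fst v - snd v))) (at (x, y))"
    by (rule has_derivative_compose[where f = "\<lambda>z. fst z - snd z" and g = U and
          g' = "\<lambda>v. gradient U (x - y) \<bullet> v"])
       (auto intro!: derivative_eq_intros U)
  then show "(f_fun U has_derivative
      (\<lambda>v. (gradient U (x - y), - gradient U (x - y)) \<bullet> v)) (at (x, y))"
    by (simp add: f_fun_def case_prod_unfold inner_prod_def inner_diff_right)
qed

lemma g_fun_derivative:
  "frechet_derivative (g_fun R \<Gamma>) (at z) = (\<lambda>(u, v). u - \<Gamma> *v v)"
proof (rule frechet_derivative_at[symmetric])
  show "(g_fun R \<Gamma> has_derivative (\<lambda>(u, v). u - \<Gamma> *v v)) (at z)"
    unfolding g_fun_def case_prod_unfold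
    by (auto intro!: derivative_eq_intros
        bounded_linear.has_derivative[OF matrix_vector_mul_bounded_linear])
qed

lemma gradient_h_fun:
  fixes \<phi> :: "real ^ 'n \<Rightarrow> real" and R \<gamma> x y :: "real ^ 'n"
  assumes "\<phi> differentiable_on orthant" "\<forall>i. 0 < \<gamma> $ i"
    and xy: "(x, y) \<in> h_dom R (diag \<gamma>)"
  defines "P \<equiv> gradient_on orthant \<phi> (R + diag \<gamma> *v y - x)"
  shows "gradient_on (h_dom R (diag \<gamma>)) (h_fun \<phi> R (diag \<gamma>)) (x, y) = (- P, diag \<gamma> *v P)"
proof (rule gradient_on_eqI)
  let ?D = "h_dom R (diag \<gamma>)"
  let ?r = "\<lambda>z. R + diag \<gamma> *v snd z - fst z"
  have r: "?r (x, y) \<in> orthant"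
    using xy by (auto simp: h_dom_def)
  have "(\<phi> has_derivative (\<lambda>v. P \<bullet> v)) (at (?r (x, y)) within orthant)"
    using has_derivative_gradient_onI[OF _ orthant_basis_direction[OF r], of \<phi>] assms(1) r
    by (auto simp: P_def differentiable_on_def)
  then have \<phi>: "(\<phi> has_derivative (\<lambda>v. P \<bullet> v)) (at (?r (x, y)) within ?r ` ?D)"
    by (rule has_derivative_subset) (auto simp: h_dom_def)
  have "(?r has_derivative (\<lambda>v. diag \<gamma> *v snd v - fst v)) (at (x, y) within ?D)"
    by (auto intro!: derivative_eq_intros
        bounded_linear.has_derivative[OF matrix_vector_mul_bounded_linear])
  from has_derivative_in_compose[OF this \<phi>]
  have "((\<lambda>z. \<phi> (?r z) - \<phi> R) has_derivative (\<lambda>v. P \<bullet> (diag \<gamma> *v snd v - fst v)))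
      (at (x, y) within ?D)"
    by (auto intro!: derivative_eq_intros)
  then show "(h_fun \<phi> R (diag \<gamma>) has_derivative (\<lambda>v. (- P, diag \<gamma> *v P) \<bullet> v))
      (at (x, y) within ?D)"
    by (simp add: h_fun_def case_prod_unfold inner_prod_def inner_diff_right diag_inner)
qed (use assms h_dom_basis_direction in blast)

end

theory Submission
  imports Defs
begin

text \<open>
  The heart of the matter is that the nonlinear constraint \<open>\<phi> (R + \<Gamma> y - x) = \<phi> R\<close> is linear in
  disguise. Let \<open>q\<close> be the gradient of \<open>\<phi>\<close> at the interior point \<open>R\<close>. Since \<open>\<phi>\<close> is quasilinear
  and \<open>q \<noteq> 0\<close>, the level set of \<open>\<phi>\<close> through \<open>R\<close> is exactly the slice of the orthant by the
  hyperplane \<open>q \<bullet> (z - R) = 0\<close> (\<open>quasilinear_level_set_eq_hyperplane\<close>), boundary points included.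
  The feasible set of the problem is therefore the polyhedron cut out of \<open>S_hat R\<close> by the single
  equation \<open>q \<bullet> (\<Gamma> y - x) = 0\<close>.

  For necessity, an optimal pair satisfies the first-order inequality of \<open>U\<close> in all directions
  into this polyhedron. The linear form \<open>q \<bullet> (\<Gamma> y - x)\<close> takes both signs on \<open>S_hat R\<close>: it is
  negative at \<open>(R, 0)\<close> and positive at \<open>(0, 1)\<close>. This Slater condition yields a multiplier \<open>t\<close>
  of \<open>q\<close> (\<open>scalar_multiplier_exists\<close>). The theorem asks for a multiplier of the gradient \<open>P\<close> at
  \<open>R + \<Gamma> ybar - xbar\<close> instead. This point may lie on the boundary of the orthant, where a gradient
  that is nonzero in the interior could vanish, so that \<open>P = 0\<close> has to be excluded. That \<open>P\<close> is
  nevertheless a positive multiple of \<open>q\<close> is \<open>gradient_positively_proportional_on_level_set\<close>. The multiplier \<open>\<mu>\<close> can be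
  taken to be \<open>0\<close>, because \<open>R + \<Gamma> y - x \<ge> 0\<close> already follows from \<open>x \<le> R\<close> and \<open>y \<ge> 0\<close>.

  For sufficiency, quasilinearity makes the \<open>l\<close>-term vanish in the direction of any feasible point,
  complementary slackness gives the \<open>\<mu>\<close>-term a sign, and what remains is the first-order
  inequality of \<open>U\<close>, which is enough for a pseudoconcave function.
\<close>

section \<open>First-order conditions along segments\<close>

lemma directional_quotient_tendsto:
  fixes f :: "'a::euclidean_space \<Rightarrow> real"
  assumes "convex S" and "z \<in> S" and "z + d \<in> S"
    and "(f has_derivative (\<lambda>v. D \<bullet> v)) (at z within S)"
  shows "((\<lambda>t. (f (z + t *\<^sub>R d) - f z) / t) \<longlongrightarrow> D \<bullet> d) (at_right 0)"
proof -
  have seg: "z + t *\<^sub>R d \<in> S" if "t \<in> {0..1}" for t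
  proof -
    have "(1 - t) *\<^sub>R z + t *\<^sub>R (z + d) \<in> S"
      using assms(1-3) that by (intro convexD) auto
    then show ?thesis by (simp add: algebra_simps)
  qed
  have "((\<lambda>t. z + t *\<^sub>R d) has_derivative (\<lambda>t. t *\<^sub>R d)) (at 0 within {0..1})"
    by (auto intro!: derivative_eq_intros)
  moreover have "(f has_derivative (\<lambda>v. D \<bullet> v))
      (at (z + 0 *\<^sub>R d) within (\<lambda>t. z + t *\<^sub>R d) ` {0..1})"
    using assms(4) seg by (auto intro: has_derivative_subset)
  ultimately have "((\<lambda>t. f (z + t *\<^sub>R d)) has_derivative (\<lambda>t. D \<bullet> (t *\<^sub>R d)))
      (at 0 within {0..1})"
    by (rule has_derivative_in_compose)
  then have "((\<lambda>t. f (z + t *\<^sub>R d)) has_field_derivative D \<bullet> d) (at 0 within {0..1})"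
    by (simp add: has_field_derivative_def mult.commute[of _ "D \<bullet> d"])
  then have "((\<lambda>t. (f (z + t *\<^sub>R d) - f z) / t) \<longlongrightarrow> D \<bullet> d) (at 0 within {0..1})"
    by (simp add: has_field_derivative_iff)
  then show ?thesis
    by (simp add: at_within_Icc_at_right)
qed

lemma directional_derivative_nonpos:
  fixes f :: "'a::euclidean_space \<Rightarrow> real"
  assumes "convex S" and "z \<in> S" and "z + d \<in> S"
    and "(f has_derivative (\<lambda>v. D \<bullet> v)) (at z within S)"
    and le: "\<And>t. 0 < t \<Longrightarrow> t < 1 \<Longrightarrow> f (z + t *\<^sub>R d) \<le> f z"
  shows "D \<bullet> d \<le> 0"
proof (rule tendsto_upperbound[OF directional_quotient_tendsto[OF assms(1-4)]])
  have "\<forall>\<^sub>F t in at_right 0. t \<in> {0<..<1::real}"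
    by (rule eventually_at_right_real) simp
  then show "\<forall>\<^sub>F t in at_right 0. (f (z + t *\<^sub>R d) - f z) / t \<le> 0"
    by eventually_elim (simp add: le divide_nonpos_pos)
qed simp

lemma quasiconvex_first_order:
  fixes f :: "'a::euclidean_space \<Rightarrow> real"
  assumes qc: "quasiconvex_on S f" and "z \<in> S" and "z' \<in> S"
    and "(f has_derivative (\<lambda>v. D \<bullet> v)) (at z within S)"
    and "f z' \<le> f z"
  shows "D \<bullet> (z' - z) \<le> 0"
proof (rule directional_derivative_nonpos[of S z "z' - z" f D])
  show "convex S" using qc by (simp add: quasiconvex_on_def)
  show "f (z + t *\<^sub>R (z' - z)) \<le> f z" if "0 < t" "t < 1" for t
  proof -
    have "f (t *\<^sub>R z' + (1 - t) *\<^sub>R z) \<le> max (f z') (f z)"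
      using qc assms(2,3) that unfolding quasiconvex_on_def by auto
    then show ?thesis using assms(5) by (simp add: algebra_simps)
  qed
qed (use assms in auto)

lemma has_derivative_neg_inner:
  assumes "(f has_derivative (\<lambda>v. D \<bullet> v)) F"
  shows "((\<lambda>x. - f x :: real) has_derivative (\<lambda>v. (- D) \<bullet> v)) F"
  using has_derivative_minus[OF assms] by simp

section \<open>Level sets of quasilinear functions\<close>

lemma quasilinear_first_order:
  fixes f :: "'a::euclidean_space \<Rightarrow> real"
  assumes "quasilinear_on S f" and "z \<in> S" and "z' \<in> S"
    and "(f has_derivative (\<lambda>v. D \<bullet> v)) (at z within S)"
    and "f z' = f z"
  shows "D \<bullet> (z' - z) = 0"
proof (rule antisym)
  show "D \<bullet> (z' - z) \<le> 0"
    using assms by (intro quasiconvex_first_order[of S f]) (auto simp: quasilinear_on_def)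
  have "(- D) \<bullet> (z' - z) \<le> 0"
    using assms has_derivative_neg_inner[OF assms(4)]
    by (intro quasiconvex_first_order[of S "\<lambda>x. - f x"]) (auto simp: quasilinear_on_def)
  then show "0 \<le> D \<bullet> (z' - z)" by simp
qed

text \<open>
  A point \<open>z\<close> of the hyperplane with a smaller value than \<open>R\<close> could be pushed a little along \<open>q\<close>
  and still have a smaller value, although it then lies strictly on the ascent side of the
  hyperplane, against the first-order inequality at \<open>R\<close>.
\<close>

lemma quasiconvex_ge_on_hyperplane:
  fixes f :: "'a::euclidean_space \<Rightarrow> real"
  assumes qc: "quasiconvex_on S f" and "R \<in> S"
    and dR: "(f has_derivative (\<lambda>v. q \<bullet> v)) (at R within S)" and "q \<noteq> 0"
    and cont: "continuous_on S f" and z: "z \<in> interior S" and hyp: "q \<bullet> (z - R) = 0"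
  shows "f R \<le> f z"
proof (rule ccontr)
  assume "\<not> f R \<le> f z"
  then have less: "f z < f R" by simp
  have "((\<lambda>t. z + t *\<^sub>R q) \<longlongrightarrow> z + 0 *\<^sub>R q) (at_right 0)"
    by (intro tendsto_intros)
  then have lim: "((\<lambda>t. z + t *\<^sub>R q) \<longlongrightarrow> z) (at_right 0)" by simp
  have inS: "\<forall>\<^sub>F t in at_right 0. z + t *\<^sub>R q \<in> interior S"
    using lim z by (metis open_interior topological_tendstoD)
  have "isCont f z"
    using cont z by (metis continuous_on_interior)
  then have "((\<lambda>t. f (z + t *\<^sub>R q)) \<longlongrightarrow> f z) (at_right 0)"
    using lim by (metis isCont_tendsto_compose)
  then have "\<forall>\<^sub>F t in at_right 0. f (z + t *\<^sub>R q) < f R"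
    using less by (rule order_tendstoD)
  moreover have "\<forall>\<^sub>F t in at_right 0. (0::real) < t"
    by (simp add: eventually_at_right_less)
  ultimately have "\<forall>\<^sub>F t in at_right 0. 0 < t \<and> f (z + t *\<^sub>R q) < f R \<and> z + t *\<^sub>R q \<in> interior S"
    using inS by eventually_elim simp
  then obtain t where t: "0 < t" "f (z + t *\<^sub>R q) < f R" "z + t *\<^sub>R q \<in> interior S"
    using eventually_happens'[OF trivial_limit_at_right_real] by blast
  have "q \<bullet> (z + t *\<^sub>R q - R) \<le> 0"
    using quasiconvex_first_order[OF qc \<open>R \<in> S\<close> _ dR] t interior_subset by fastforce
  also have "q \<bullet> (z + t *\<^sub>R q - R) = t * (q \<bullet> q)"
    using hyp by (simp add: inner_diff_right inner_add_right)
  finally show False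
    using t(1) \<open>q \<noteq> 0\<close> by (simp add: mult_le_0_iff flip: not_less)
qed

text \<open>
  Pushing along \<open>q\<close> is possible only inside \<open>S\<close>. A boundary point of the hyperplane slice is
  reached as the limit of the segment from \<open>R\<close>, which runs inside the hyperplane and the interior.
\<close>

lemma quasilinear_level_set_eq_hyperplane:
  fixes f :: "'a::euclidean_space \<Rightarrow> real"
  assumes ql: "quasilinear_on S f" and R: "R \<in> interior S"
    and dR: "(f has_derivative (\<lambda>v. q \<bullet> v)) (at R within S)" and "q \<noteq> 0"
    and cont: "continuous_on S f" and z: "z \<in> S"
  shows "f z = f R \<longleftrightarrow> q \<bullet> (z - R) = 0"
proof
  have RS: "R \<in> S" using R interior_subset by blast
  show "q \<bullet> (z - R) = 0" if "f z = f R"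
    using quasilinear_first_order[OF ql RS z dR that] .
  assume hyp: "q \<bullet> (z - R) = 0"
  have inner_eq: "f u = f R" if u: "u \<in> interior S" "q \<bullet> (u - R) = 0" for u
  proof (rule antisym)
    show "f R \<le> f u"
      using ql by (intro quasiconvex_ge_on_hyperplane[OF _ RS dR \<open>q \<noteq> 0\<close> cont u])
        (simp add: quasilinear_on_def)
    have "- f R \<le> - f u"
    proof (rule quasiconvex_ge_on_hyperplane[OF _ RS has_derivative_neg_inner[OF dR] _ _ u(1)])
      show "continuous_on S (\<lambda>x. - f x)" using cont by (rule continuous_on_minus)
    qed (use ql u(2) \<open>q \<noteq> 0\<close> in \<open>auto simp: quasilinear_on_def\<close>)
    then show "f u \<le> f R" by simp
  qed
  have cS: "convex S" using ql by (simp add: quasilinear_on_def quasiconvex_on_def)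
  let ?u = "\<lambda>t. z - t *\<^sub>R (z - R)"
  have int: "?u t \<in> interior S" if "0 < t" "t < 1" for t
    using mem_interior_convex_shrink[OF cS R z] that by simp
  have "\<forall>\<^sub>F t in at_right 0. t \<in> {0<..<1::real}"
    by (rule eventually_at_right_real) simp
  then have ev: "\<forall>\<^sub>F t in at_right 0. ?u t \<in> S \<and> f (?u t) = f R"
  proof eventually_elim
    case (elim t)
    then have "?u t \<in> interior S" by (intro int) auto
    moreover have "q \<bullet> (?u t - R) = 0"
      using hyp by (simp add: inner_diff_right algebra_simps)
    ultimately show ?case using inner_eq interior_subset by blast
  qed
  have "(?u \<longlongrightarrow> z - 0 *\<^sub>R (z - R)) (at_right 0)"
    by (intro tendsto_intros)
  then have "(?u \<longlongrightarrow> z) (at_right 0)" by simp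
  then have "((\<lambda>t. f (?u t)) \<longlongrightarrow> f z) (at_right 0)"
    by (rule continuous_on_tendsto_compose[OF cont _ z]) (use ev in \<open>auto elim: eventually_mono\<close>)
  moreover have "((\<lambda>t. f (?u t)) \<longlongrightarrow> f R) (at_right 0)"
    by (rule tendsto_eventually) (use ev in \<open>auto elim: eventually_mono\<close>)
  ultimately show "f z = f R"
    using tendsto_unique[OF trivial_limit_at_right_real] by blast
qed

text \<open>
  The two gradients are parallel because \<open>P\<close> annihilates the hyperplane slice, which contains a
  neighbourhood of \<open>R\<close> in the hyperplane. The point is that \<open>P\<close> does not vanish even if \<open>z\<close> lies on
  the boundary of \<open>S\<close>. Put \<open>w = R - z\<close> and prolong the segment from \<open>z\<close> to \<open>R\<close> beyond \<open>R\<close> to a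
  point \<open>R + \<kappa> w\<close>. Lift the near end to \<open>z + s (w + \<delta> q)\<close> and slide the far end within the level
  set to \<open>R + \<kappa> (1 - s) w\<close>: the point dividing the new segment in the fixed ratio
  \<open>\<theta> = \<kappa> / (1 + \<kappa>)\<close> is then exactly \<open>R + s \<theta> \<delta> q\<close>. By quasiconvexity the increase of \<open>f\<close> at the
  near end is at least the increase at \<open>R\<close>, which is of first order in \<open>s\<close>, and so
  \<open>P \<bullet> (w + \<delta> q) > 0\<close>.
\<close>

lemma gradient_positively_proportional_on_level_set:
  fixes f :: "'a::euclidean_space \<Rightarrow> real"
  assumes ql: "quasilinear_on S f" and R: "R \<in> interior S"
    and dR: "(f has_derivative (\<lambda>v. q \<bullet> v)) (at R within S)" and "q \<noteq> 0"
    and cont: "continuous_on S f" and z: "z \<in> S" and fz: "f z = f R"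
    and dz: "(f has_derivative (\<lambda>v. P \<bullet> v)) (at z within S)"
  shows "\<exists>\<rho>>0. P = \<rho> *\<^sub>R q"
proof -
  note level = quasilinear_level_set_eq_hyperplane[OF ql R dR \<open>q \<noteq> 0\<close> cont]
  have cS: "convex S" and qc: "quasiconvex_on S f"
    using ql by (auto simp: quasilinear_on_def quasiconvex_on_def)
  have RS: "R \<in> S" using R interior_subset by blast
  define w where "w = R - z"
  have qw: "q \<bullet> w = 0"
    using level[OF z] fz by (simp add: w_def inner_diff_right)
  have Pw: "P \<bullet> w = 0"
    using quasilinear_first_order[OF ql z RS dz] fz by (simp add: w_def)
  have qq: "0 < q \<bullet> q" using \<open>q \<noteq> 0\<close> by simp
  obtain r where r: "0 < r" "cball R r \<subseteq> S"
    using R by (auto simp: mem_interior_cball)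
  have small: "\<exists>t>0. R + t *\<^sub>R v \<in> S" for v
  proof (cases "v = 0")
    case False
    then have "R + (r / norm v) *\<^sub>R v \<in> S"
      using r by (intro subsetD[OF r(2)]) (simp add: dist_norm)
    then show ?thesis using r(1) False by (intro exI[of _ "r / norm v"]) simp
  qed (use RS in \<open>auto intro: exI[of _ 1]\<close>)

  have orth: "P \<bullet> v = 0" if v: "q \<bullet> v = 0" for v
  proof -
    obtain t where t: "t > 0" "R + t *\<^sub>R v \<in> S" using small by blast
    have "f (R + t *\<^sub>R v) = f z"
      using level[OF t(2)] v fz by simp
    from quasilinear_first_order[OF ql z t(2) dz this]
    have "P \<bullet> (w + t *\<^sub>R v) = 0" by (simp add: w_def algebra_simps)
    then show ?thesis using Pw t(1) by (simp add: inner_add_right)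
  qed
  define \<rho> where "\<rho> = (P \<bullet> q) / (q \<bullet> q)"
  have "q \<bullet> (P - \<rho> *\<^sub>R q) = 0"
    using qq by (simp add: \<rho>_def inner_diff_right inner_commute[of P])
  then have "P \<bullet> (P - \<rho> *\<^sub>R q) = 0" and "q \<bullet> (P - \<rho> *\<^sub>R q) = 0"
    using orth by blast+
  then have "(P - \<rho> *\<^sub>R q) \<bullet> (P - \<rho> *\<^sub>R q) = 0"
    by (simp add: inner_diff_left)
  then have P_eq: "P = \<rho> *\<^sub>R q" by simp

  obtain \<delta> where \<delta>: "\<delta> > 0" "R + \<delta> *\<^sub>R q \<in> S" using small by blast
  obtain \<kappa> where \<kappa>: "\<kappa> > 0" "R + \<kappa> *\<^sub>R w \<in> S" using small by blast
  define \<theta> where "\<theta> = \<kappa> / (1 + \<kappa>)"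
  have \<theta>: "0 < \<theta>" "\<theta> < 1" using \<kappa>(1) by (auto simp: \<theta>_def)
  have \<theta>\<kappa>: "(1 - \<theta>) * \<kappa> = \<theta>" using \<kappa>(1) by (simp add: \<theta>_def field_simps)
  define d where "d = w + \<delta> *\<^sub>R q"
  have zd: "z + d \<in> S" using \<delta>(2) by (simp add: d_def w_def)
  have on_seg: "u + t *\<^sub>R v \<in> S" if "u \<in> S" "u + v \<in> S" "0 < t" "t < 1" for t u v
  proof -
    have "(1 - t) *\<^sub>R u + t *\<^sub>R (u + v) \<in> S"
      using cS that by (intro convexD) auto
    then show ?thesis by (simp add: algebra_simps)
  qed
  have R\<theta>: "R + (\<theta> * \<delta>) *\<^sub>R q \<in> S"
    using on_seg[OF RS \<delta>(2) \<theta>] by simp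
  have compare: "f (R + s *\<^sub>R ((\<theta> * \<delta>) *\<^sub>R q)) \<le> max (f (z + s *\<^sub>R d)) (f R)"
    if s: "0 < s" "s < 1" for s
  proof -
    let ?Y = "R + (1 - s) *\<^sub>R (\<kappa> *\<^sub>R w)"
    have Y: "?Y \<in> S" by (rule on_seg[OF RS \<kappa>(2)]) (use s in auto)
    have "f ?Y = f R" using level[OF Y] qw by simp
    moreover have "f (\<theta> *\<^sub>R (z + s *\<^sub>R d) + (1 - \<theta>) *\<^sub>R ?Y) \<le> max (f (z + s *\<^sub>R d)) (f ?Y)"
      using qc on_seg[OF z zd s] Y \<theta> unfolding quasiconvex_on_def by auto
    moreover have "\<theta> *\<^sub>R (z + s *\<^sub>R d) + (1 - \<theta>) *\<^sub>R ?Y = R + s *\<^sub>R ((\<theta> * \<delta>) *\<^sub>R q)"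
    proof -
      have "(1 - \<theta>) *\<^sub>R ((1 - s) *\<^sub>R (\<kappa> *\<^sub>R w)) = ((1 - s) * ((1 - \<theta>) * \<kappa>)) *\<^sub>R w"
        by (simp add: ac_simps)
      also have "\<dots> = ((1 - s) * \<theta>) *\<^sub>R w" by (simp only: \<theta>\<kappa>)
      finally have "(1 - \<theta>) *\<^sub>R ?Y = (1 - \<theta>) *\<^sub>R (z + w) + ((1 - s) * \<theta>) *\<^sub>R w"
        by (simp add: scaleR_add_right w_def)
      then show ?thesis by (simp add: d_def w_def algebra_simps)
    qed
    ultimately show ?thesis by simp
  qed
  let ?near = "\<lambda>s. (f (z + s *\<^sub>R d) - f z) / s"
  let ?atR = "\<lambda>s. (f (R + s *\<^sub>R ((\<theta> * \<delta>) *\<^sub>R q)) - f R) / s"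
  have near: "(?near \<longlongrightarrow> P \<bullet> d) (at_right 0)"
    by (rule directional_quotient_tendsto[OF cS z zd dz])
  have atR: "(?atR \<longlongrightarrow> q \<bullet> ((\<theta> * \<delta>) *\<^sub>R q)) (at_right 0)"
    by (rule directional_quotient_tendsto[OF cS RS R\<theta> dR])
  have pos: "0 < q \<bullet> ((\<theta> * \<delta>) *\<^sub>R q)"
    using \<theta> \<delta>(1) qq by simp
  have "\<forall>\<^sub>F s in at_right 0. 0 < ?atR s"
    using atR pos by (rule order_tendstoD)
  moreover have "\<forall>\<^sub>F s in at_right 0. s \<in> {0<..<1::real}"
    by (rule eventually_at_right_real) simp
  ultimately have "\<forall>\<^sub>F s in at_right 0. ?atR s \<le> ?near s"
  proof eventually_elim
    case (elim s)
    then have s: "0 < s" "s < 1" by auto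
    have "f R < f (R + s *\<^sub>R ((\<theta> * \<delta>) *\<^sub>R q))"
      using elim(1) s by (simp add: zero_less_divide_iff)
    with compare[OF s] fz show ?case
      using s by (intro divide_right_mono) auto
  qed
  from tendsto_le[OF trivial_limit_at_right_real near atR this] pos
  have "0 < P \<bullet> d" by linarith
  then have "0 < \<delta> * (\<rho> * (q \<bullet> q))"
    using Pw by (simp add: d_def inner_add_right) (simp add: P_eq)
  then have "0 < \<rho>" using \<delta>(1) qq by (simp add: zero_less_mult_iff)
  with P_eq show ?thesis by blast
qed

section \<open>A multiplier for one linear equation\<close>

text \<open>
  The multiplier has to lie above all quotients \<open>- p \<bullet> (s - c) / v \<bullet> (s - c)\<close> from the side where the
  denominator is positive and below those from the other side. The segment between two points of
  opposite sides meets the hyperplane, and the hypothesis there says that the first kind of quotient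
  never exceeds the second. As both sides are inhabited, the supremum of the first kind exists.
\<close>

lemma scalar_multiplier_exists:
  fixes v p c :: "'a::real_inner"
  assumes C: "convex C"
    and pos: "s1 \<in> C" "0 < v \<bullet> (s1 - c)" and neg: "s2 \<in> C" "v \<bullet> (s2 - c) < 0"
    and opt: "\<And>s. s \<in> C \<Longrightarrow> v \<bullet> (s - c) = 0 \<Longrightarrow> 0 \<le> p \<bullet> (s - c)"
  shows "\<exists>t. \<forall>s\<in>C. 0 \<le> p \<bullet> (s - c) + t * (v \<bullet> (s - c))"
proof -
  let ?A = "\<lambda>s. v \<bullet> (s - c)" and ?B = "\<lambda>s. p \<bullet> (s - c)"
  have sep: "- ?B s / ?A s \<le> - ?B s' / ?A s'"
    if s: "s \<in> C" "0 < ?A s" and s': "s' \<in> C" "?A s' < 0" for s s'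
  proof -
    let ?k = "?A s - ?A s'"
    have k: "0 < ?k" using s s' by simp
    define m where "m = (- ?A s' / ?k) *\<^sub>R s + (?A s / ?k) *\<^sub>R s'"
    have one: "- ?A s' / ?k + ?A s / ?k = 1"
      using k unfolding add_divide_distrib[symmetric] by simp
    have "m \<in> C"
      unfolding m_def using s s' k one by (intro convexD[OF C]) (auto simp: divide_nonpos_pos)
    have "m - c = m - (- ?A s' / ?k + ?A s / ?k) *\<^sub>R c" using one by simp
    also have "\<dots> = (- ?A s' / ?k) *\<^sub>R (s - c) + (?A s / ?k) *\<^sub>R (s' - c)"
      by (simp only: m_def scaleR_add_left scaleR_diff_right) simp
    finally have m: "m - c = (- ?A s' / ?k) *\<^sub>R (s - c) + (?A s / ?k) *\<^sub>R (s' - c)" .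
    have lin: "u \<bullet> (m - c) = - ?A s' / ?k * (u \<bullet> (s - c)) + ?A s / ?k * (u \<bullet> (s' - c))" for u
      unfolding m by (simp only: inner_add_right inner_scaleR_right)
    have "?A m = 0" unfolding lin by (simp add: mult.commute)
    then have "0 \<le> ?B m" using opt \<open>m \<in> C\<close> by blast
    also have "?B m = (?A s * ?B s' - ?A s' * ?B s) / ?k"
      unfolding lin by (simp add: diff_divide_distrib)
    finally have "0 \<le> ?A s * ?B s' - ?A s' * ?B s"
      using k by (simp add: zero_le_divide_iff)
    then show ?thesis using s s' by (simp add: field_simps)
  qed
  define X where "X = (\<lambda>s. - ?B s / ?A s) ` {s \<in> C. 0 < ?A s}"
  have bdd: "bdd_above X"
    unfolding X_def using sep[OF _ _ neg] by (intro bdd_aboveI2[of _ _ "- ?B s2 / ?A s2"]) auto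
  have "0 \<le> ?B s + Sup X * ?A s" if s: "s \<in> C" for s
  proof -
    consider "0 < ?A s" | "?A s < 0" | "?A s = 0" by linarith
    then show ?thesis
    proof cases
      case 1
      then have "- ?B s / ?A s \<le> Sup X"
        using s by (intro cSup_upper[OF _ bdd]) (auto simp: X_def)
      then show ?thesis using 1 by (simp add: field_simps)
    next
      case 2
      then have "Sup X \<le> - ?B s / ?A s"
        using pos s sep by (intro cSup_least) (auto simp: X_def)
      then show ?thesis using 2 by (simp add: field_simps)
    next
      case 3
      then show ?thesis using opt[OF s] by simp
    qed
  qed
  then show ?thesis by blast
qed

section \<open>Optimality conditions for the trading problem\<close>

lemma positive_vector_in_interior_orthant:
  assumes "\<forall>i. 0 < R $ i"
  shows "R \<in> interior orthant"
proof -
  have "open {x::real^'n. \<forall>i. 0 < x $ i}"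
    unfolding Collect_all_eq by (intro open_INT ballI open_Collect_less continuous_intros) simp
  moreover have "{x::real^'n. \<forall>i. 0 < x $ i} \<subseteq> orthant"
    by (auto simp: orthant_def less_eq_vec_def less_imp_le)
  ultimately show ?thesis using assms interior_maximal by blast
qed

lemma convex_S_hat: "convex (S_hat R)"
  by (auto simp: convex_def S_hat_def less_eq_vec_def intro!: convex_bound_le)

lemma reserves_after_trade_in_orthant:
  assumes "(x, y) \<in> S_hat R" and "\<forall>i. 0 < \<gamma> $ i"
  shows "R + diag \<gamma> *v y - x \<in> orthant"
proof -
  have "x $ i \<le> R $ i + \<gamma> $ i * y $ i" for i
    using assms by (simp add: S_hat_def less_eq_vec_def add_increasing2 less_imp_le)
  then show ?thesis by (simp add: orthant_def less_eq_vec_def diag_mult)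
qed

lemma inner_vec_nonneg:
  assumes "0 \<le> u" and "0 \<le> v"
  shows "0 \<le> u \<bullet> (v :: real ^ 'n)"
  using assms by (simp add: inner_vec_def less_eq_vec_def sum_nonneg)

lemma inner_vec_pos:
  assumes "0 \<le> u" and "u \<noteq> 0" and "\<forall>i. 0 < v $ i"
  shows "0 < u \<bullet> (v :: real ^ 'n)"
proof -
  obtain i where "u $ i \<noteq> 0" using assms(2) by (auto simp: vec_eq_iff)
  then have "0 < u $ i" using assms(1) by (simp add: less_eq_vec_def less_le)
  then show ?thesis
    using assms by (auto simp: inner_vec_def less_eq_vec_def less_imp_le intro!: sum_pos2[of _ i])
qed

lemma gradient_uminus:
  fixes f :: "'a::euclidean_space \<Rightarrow> real"
  assumes "(f has_derivative (\<lambda>v. D \<bullet> v)) (at x)"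
  shows "gradient (\<lambda>x. - f x) x = - D"
  using assms by (intro gradient_eqI has_derivative_neg_inner)

theorem theorem3p3:
  fixes U \<phi> :: "real ^ 'n \<Rightarrow> real"
    and R \<gamma> xbar ybar :: "real ^ 'n"
    and \<Gamma> :: "real ^ 'n ^ 'n"
  assumes R_pos: "\<forall>i. 0 < R $ i"
    and \<gamma>: "\<forall>i. 0 < \<gamma> $ i \<and> \<gamma> $ i < 1"
    and \<Gamma>: "\<Gamma> = diag \<gamma>"
    and \<phi>_nonneg: "\<forall>x\<in>orthant. 0 \<le> \<phi> x"
    and U_C1: "C1_on UNIV U"
    and \<phi>_C1: "C1_on orthant \<phi>"
    and U_pseudoconcave: "pseudoconcave U"
    and \<phi>_quasilinear: "quasilinear_on orthant \<phi>"
    and grad_U: "\<forall>x. 0 \<le> gradient U x"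
    and grad_\<phi>: "\<forall>x. (\<forall>i. 0 < x $ i) \<longrightarrow>
          0 \<le> gradient_on orthant \<phi> x \<and> gradient_on orthant \<phi> x \<noteq> 0"
    and in_S_hat: "(xbar, ybar) \<in> S_hat R"
    and xbar_nonneg: "0 \<le> xbar"
    and ybar_nonneg: "0 \<le> ybar"
    and complementary: "\<forall>i. xbar $ i * ybar $ i = 0"
  shows "solves_Q U \<phi> R \<Gamma> xbar ybar \<longleftrightarrow>
    (\<exists>\<mu>\<in>orthant. \<exists>l::real.
       (\<forall>(x, y)\<in>S_hat R.
          let d = (x - xbar, y - ybar) in
          - (gradient (f_fun U) (xbar, ybar) \<bullet> d)
          + \<mu> \<bullet> frechet_derivative (g_fun R \<Gamma>) (at (xbar, ybar)) d
          + l * (gradient_on (h_dom R \<Gamma>) (h_fun \<phi> R \<Gamma>) (xbar, ybar) \<bullet> d) \<ge> 0)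
       \<and> \<mu> \<bullet> g_fun R \<Gamma> (xbar, ybar) = 0
       \<and> h_fun \<phi> R \<Gamma> (xbar, ybar) = 0)"
proof -
  let ?z = "\<lambda>x y. R + \<Gamma> *v y - x"
  let ?zbar = "?z xbar ybar"
  define G where "G = gradient U (xbar - ybar)"
  define q where "q = gradient_on orthant \<phi> R"
  define P where "P = gradient_on orthant \<phi> ?zbar"
  have \<gamma>_pos: "\<forall>i. 0 < \<gamma> $ i" using \<gamma> by blast
  have dU: "(U has_derivative (\<lambda>v. G \<bullet> v)) (at (xbar - ybar))"
    unfolding G_def
  proof (rule has_derivative_gradient_onI)
    show "\<exists>d. 0 < \<bar>d\<bar> \<and> \<bar>d\<bar> < e \<and> xbar - ybar + d *\<^sub>R i \<in> UNIV" if "e > 0" for i e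
      using that by (intro exI[of _ "e / 2"]) simp
  qed (use U_C1 in \<open>simp add: C1_on_def differentiable_on_def\<close>)
  have \<phi>_diff: "\<phi> differentiable_on orthant" using \<phi>_C1 by (simp add: C1_on_def)
  have d\<phi>: "(\<phi> has_derivative (\<lambda>v. gradient_on orthant \<phi> z \<bullet> v)) (at z within orthant)"
    if "z \<in> orthant" for z
    using that \<phi>_diff
    by (intro has_derivative_gradient_onI orthant_basis_direction) (auto simp: differentiable_on_def)
  have cont: "continuous_on orthant \<phi>"
    using \<phi>_diff by (rule differentiable_imp_continuous_on)
  have R_int: "R \<in> interior orthant" using R_pos by (rule positive_vector_in_interior_orthant)
  then have R_in: "R \<in> orthant" using interior_subset by blast
  have dR: "(\<phi> has_derivative (\<lambda>v. q \<bullet> v)) (at R within orthant)"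
    using d\<phi>[OF R_in] by (simp add: q_def)
  have q: "0 \<le> q" "q \<noteq> 0" using grad_\<phi> R_pos by (auto simp: q_def)
  have z_in: "?z x y \<in> orthant" if "(x, y) \<in> S_hat R" for x y
    using reserves_after_trade_in_orthant[OF that \<gamma>_pos] by (simp add: \<Gamma>)
  have zbar_in: "?zbar \<in> orthant" using in_S_hat by (rule z_in)
  have dP: "(\<phi> has_derivative (\<lambda>v. P \<bullet> v)) (at ?zbar within orthant)"
    using d\<phi>[OF zbar_in] by (simp add: P_def)
  have feasible_iff: "(x, y) \<in> feasible_Q \<phi> R \<Gamma> \<longleftrightarrow> (x, y) \<in> S_hat R \<and> \<phi> (?z x y) = \<phi> R" for x y
    using z_in[of x y] by (auto simp: feasible_Q_def S_hat_def orthant_def)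
  have level: "\<phi> z = \<phi> R \<longleftrightarrow> q \<bullet> (z - R) = 0" if "z \<in> orthant" for z
    by (rule quasilinear_level_set_eq_hyperplane[OF \<phi>_quasilinear R_int dR q(2) cont that])
  have z_diff: "?z x y - ?zbar = \<Gamma> *v (y - ybar) - (x - xbar)" for x y
    by (simp add: matrix_vector_mult_diff_distrib)
  have gf: "gradient (f_fun U) (xbar, ybar) = (G, - G)"
    unfolding G_def using dU by (intro gradient_f_fun) (auto simp: differentiable_def)
  have "gradient_on (h_dom R \<Gamma>) (h_fun \<phi> R \<Gamma>) (xbar, ybar) = (- P, \<Gamma> *v P)"
    unfolding P_def \<Gamma> using zbar_in
    by (intro gradient_h_fun[OF \<phi>_diff \<gamma>_pos]) (simp add: h_dom_def \<Gamma>)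
  then have gh: "gradient_on (h_dom R \<Gamma>) (h_fun \<phi> R \<Gamma>) (xbar, ybar) \<bullet> (x - xbar, y - ybar)
      = P \<bullet> (?z x y - ?zbar)" for x y
    unfolding z_diff unfolding \<Gamma> by (simp add: inner_diff_right diag_inner)
  \<comment> \<open>The derivatives depend on the direction only through the change of \<open>x - y\<close> (for \<open>f\<close>) and of
      the reserves \<open>?z x y\<close> (for \<open>g\<close> and \<open>h\<close>).\<close>
  have lagrangian: "- (gradient (f_fun U) (xbar, ybar) \<bullet> (x - xbar, y - ybar))
      + \<mu> \<bullet> frechet_derivative (g_fun R \<Gamma>) (at (xbar, ybar)) (x - xbar, y - ybar)
      + l * (gradient_on (h_dom R \<Gamma>) (h_fun \<phi> R \<Gamma>) (xbar, ybar) \<bullet> (x - xbar, y - ybar))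
      = - (G \<bullet> ((x - y) - (xbar - ybar))) - \<mu> \<bullet> (?z x y - ?zbar) + l * (P \<bullet> (?z x y - ?zbar))"
    for \<mu> l x y
    unfolding gf gh g_fun_derivative z_diff by (simp add: inner_diff_right)
  have g_eq: "g_fun R \<Gamma> (xbar, ybar) = - ?zbar" by (simp add: g_fun_def)
  have h_eq: "h_fun \<phi> R \<Gamma> (xbar, ybar) = \<phi> ?zbar - \<phi> R" by (simp add: h_fun_def)

  show ?thesis
  proof
    assume sol: "solves_Q U \<phi> R \<Gamma> xbar ybar"
    then have \<phi>_bar: "\<phi> ?zbar = \<phi> R"
      and best: "\<And>x y. (x, y) \<in> S_hat R \<Longrightarrow> \<phi> (?z x y) = \<phi> R \<Longrightarrow> U (x - y) \<le> U (xbar - ybar)"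
      unfolding solves_Q_def by (auto simp: feasible_iff)
    obtain \<rho> where \<rho>: "\<rho> > 0" "P = \<rho> *\<^sub>R q"
      using gradient_positively_proportional_on_level_set
        [OF \<phi>_quasilinear R_int dR q(2) cont zbar_in \<phi>_bar dP] by blast
    have q_bar: "q \<bullet> (?zbar - R) = 0" using level[OF zbar_in] \<phi>_bar by blast
    define v where "v = (- q, \<Gamma> *v q)"
    let ?s = "(xbar, ybar)"
    have v_eq: "v \<bullet> ((x, y) - ?s) = q \<bullet> (?z x y - ?zbar)" for x y
      unfolding z_diff v_def unfolding \<Gamma> by (simp add: inner_diff_right diag_inner)
    have v_eq': "v \<bullet> ((x, y) - ?s) = q \<bullet> (?z x y - R)" for x y
    proof -
      have "?z x y - ?zbar = (?z x y - R) - (?zbar - R)" by simp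
      then show ?thesis
        using q_bar unfolding v_eq by (simp only: inner_diff_right[of q "?z x y - R"])
    qed
    have "\<exists>t. \<forall>s\<in>S_hat R. 0 \<le> (- G, G) \<bullet> (s - ?s) + t * (v \<bullet> (s - ?s))"
    proof (rule scalar_multiplier_exists[OF convex_S_hat])
      show "(0, 1) \<in> S_hat R" "(R, 0) \<in> S_hat R"
        using R_pos by (auto simp: S_hat_def less_eq_vec_def less_imp_le)
      have "0 < q \<bullet> (\<Gamma> *v 1)"
        using \<gamma>_pos by (intro inner_vec_pos q) (simp add: \<Gamma> diag_mult)
      then show "0 < v \<bullet> ((0, 1) - ?s)" unfolding v_eq' by simp
      have "0 < q \<bullet> R" using R_pos by (intro inner_vec_pos q)
      then show "v \<bullet> ((R, 0) - ?s) < 0" unfolding v_eq' by (simp add: inner_diff_right)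
      show "0 \<le> (- G, G) \<bullet> (s - ?s)" if s: "s \<in> S_hat R" "v \<bullet> (s - ?s) = 0" for s
      proof -
        obtain x y where xy: "s = (x, y)" by force
        have "G \<bullet> ((x - y) - (xbar - ybar)) \<le> 0"
        proof (rule directional_derivative_nonpos[OF _ _ _ dU])
          fix t :: real assume t: "0 < t" "t < 1"
          let ?x = "xbar + t *\<^sub>R (x - xbar)" and ?y = "ybar + t *\<^sub>R (y - ybar)"
          have "(1 - t) *\<^sub>R ?s + t *\<^sub>R s \<in> S_hat R"
            using convex_S_hat in_S_hat s(1) t by (intro convexD) auto
          then have in_S: "(?x, ?y) \<in> S_hat R" by (simp add: xy algebra_simps)
          have "(?x, ?y) - ?s = t *\<^sub>R (s - ?s)" by (simp add: xy)
          then have "v \<bullet> ((?x, ?y) - ?s) = 0" using s(2) by simp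
          then have "\<phi> (?z ?x ?y) = \<phi> R"
            unfolding v_eq' using level[OF z_in[OF in_S]] by blast
          then have "U (?x - ?y) \<le> U (xbar - ybar)" using best in_S by blast
          then show "U (xbar - ybar + t *\<^sub>R ((x - y) - (xbar - ybar))) \<le> U (xbar - ybar)"
            by (simp add: algebra_simps)
        qed auto
        then show ?thesis by (simp add: xy inner_diff_right)
      qed
    qed
    then obtain t where t: "\<And>s. s \<in> S_hat R \<Longrightarrow> 0 \<le> (- G, G) \<bullet> (s - ?s) + t * (v \<bullet> (s - ?s))"
      by blast
    show "\<exists>\<mu>\<in>orthant. \<exists>l::real.
       (\<forall>(x, y)\<in>S_hat R.
          let d = (x - xbar, y - ybar) in
          - (gradient (f_fun U) (xbar, ybar) \<bullet> d)
          + \<mu> \<bullet> frechet_derivative (g_fun R \<Gamma>) (at (xbar, ybar)) d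
          + l * (gradient_on (h_dom R \<Gamma>) (h_fun \<phi> R \<Gamma>) (xbar, ybar) \<bullet> d) \<ge> 0)
       \<and> \<mu> \<bullet> g_fun R \<Gamma> (xbar, ybar) = 0
       \<and> h_fun \<phi> R \<Gamma> (xbar, ybar) = 0"
    \<comment> \<open>Since \<open>P = \<rho> q\<close>, the multiplier \<open>t\<close> of \<open>q\<close> amounts to \<open>t / \<rho>\<close> for \<open>P\<close>.\<close>
    proof (rule bexI[of _ 0], rule exI[of _ "t / \<rho>"], intro conjI ballI)
      show "case s of (x, y) \<Rightarrow>
          let d = (x - xbar, y - ybar) in
          - (gradient (f_fun U) (xbar, ybar) \<bullet> d)
          + 0 \<bullet> frechet_derivative (g_fun R \<Gamma>) (at (xbar, ybar)) d
          + t / \<rho> * (gradient_on (h_dom R \<Gamma>) (h_fun \<phi> R \<Gamma>) (xbar, ybar) \<bullet> d) \<ge> 0"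
        if "s \<in> S_hat R" for s
      proof -
        obtain x y where xy: "s = (x, y)" by force
        have "t / \<rho> * (P \<bullet> (?z x y - ?zbar)) = t * (v \<bullet> (s - ?s))"
          using \<rho>(1) unfolding xy v_eq \<rho>(2) by simp
        moreover have "(- G, G) \<bullet> (s - ?s) = - (G \<bullet> ((x - y) - (xbar - ybar)))"
          by (simp add: xy inner_diff_right)
        ultimately show ?thesis
          using t[OF that] unfolding xy prod.case Let_def lagrangian by simp
      qed
      show "0 \<bullet> g_fun R \<Gamma> (xbar, ybar) = 0" by simp
      show "h_fun \<phi> R \<Gamma> (xbar, ybar) = 0" using \<phi>_bar by (simp add: h_eq)
      show "0 \<in> orthant" by (simp add: orthant_def)
    qed
  next
    assume "\<exists>\<mu>\<in>orthant. \<exists>l::real.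
       (\<forall>(x, y)\<in>S_hat R.
          let d = (x - xbar, y - ybar) in
          - (gradient (f_fun U) (xbar, ybar) \<bullet> d)
          + \<mu> \<bullet> frechet_derivative (g_fun R \<Gamma>) (at (xbar, ybar)) d
          + l * (gradient_on (h_dom R \<Gamma>) (h_fun \<phi> R \<Gamma>) (xbar, ybar) \<bullet> d) \<ge> 0)
       \<and> \<mu> \<bullet> g_fun R \<Gamma> (xbar, ybar) = 0
       \<and> h_fun \<phi> R \<Gamma> (xbar, ybar) = 0"
    then obtain \<mu> l where \<mu>: "\<mu> \<in> orthant" "\<mu> \<bullet> ?zbar = 0" and \<phi>_bar: "\<phi> ?zbar = \<phi> R"
      and vi: "\<And>x y. (x, y) \<in> S_hat R \<Longrightarrow>
        0 \<le> - (G \<bullet> ((x - y) - (xbar - ybar))) - \<mu> \<bullet> (?z x y - ?zbar) + l * (P \<bullet> (?z x y - ?zbar))"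
      unfolding Let_def lagrangian g_eq h_eq Ball_def split_paired_All prod.case
        inner_minus_right neg_equal_0_iff_equal right_minus_eq
      by blast
    show "solves_Q U \<phi> R \<Gamma> xbar ybar"
      unfolding solves_Q_def
    proof (intro conjI ballI)
      show "(xbar, ybar) \<in> feasible_Q \<phi> R \<Gamma>" using in_S_hat \<phi>_bar by (simp add: feasible_iff)
      fix s assume s: "s \<in> feasible_Q \<phi> R \<Gamma>"
      obtain x y where xy: "s = (x, y)" by force
      have in_S: "(x, y) \<in> S_hat R" and "\<phi> (?z x y) = \<phi> ?zbar"
        using s \<phi>_bar by (auto simp: feasible_iff xy)
      then have "P \<bullet> (?z x y - ?zbar) = 0"
        by (intro quasilinear_first_order[OF \<phi>_quasilinear zbar_in z_in dP])
      moreover have "0 \<le> \<mu> \<bullet> ?z x y"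
        using \<mu>(1) z_in[OF in_S] by (intro inner_vec_nonneg) (auto simp: orthant_def)
      then have "0 \<le> \<mu> \<bullet> (?z x y - ?zbar)"
        using \<mu>(2) unfolding inner_diff_right[of \<mu> "?z x y"] by simp
      ultimately have "G \<bullet> ((x - y) - (xbar - ybar)) \<le> 0"
        using vi[OF in_S] by simp
      moreover have "gradient (\<lambda>u. - U u) (xbar - ybar) = - G" using dU by (rule gradient_uminus)
      ultimately have "\<not> U (xbar - ybar) < U (x - y)"
        using U_pseudoconcave unfolding pseudoconcave_def pseudoconvex_def
        by (metis inner_minus_left neg_less_0_iff_less neg_less_iff_less not_less)
      then show "case s of (x', y') \<Rightarrow> U (x' - y') \<le> U (xbar - ybar)" by (simp add: xy)
    qed
  qed
qed

end
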